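(* Let $G=(V,w,\mu)$ be a finite connected weighted graph with non-negative Bakry-Émery curvature. Then $\beta_1(M_2^{\mathrm{path}}(G))\le\deg_{\min}-1$.
   Context: $V$ finite, $w:V\times V\to[0,\infty)$ symmetric vanishing on the diagonal, $\mu:V\to(0,\infty)$, $x\sim y$ iff $w(x,y)>0$, $G$ connected; $\deg(x)=|\{y:y\sim x\}|$, $\deg_{\min}=\min_x\deg(x)$. Laplacian $\Delta f(x)=\sum_y\frac{w(x,y)}{\mu(x)}(f(y)-f(x))$. $\Gamma(f,g)=\frac12(\Delta(fg)-f\Delta g-g\Delta f)$, $\Gamma_2(f,g)=\frac12(\Delta\Gamma(f,g)-\Gamma(f,\Delta g)-\Gamma(g,\Delta f))$, $\Gamma(f)=\Gamma(f,f)$, $\Gamma_2(f)=\Gamma_2(f,f)$. A vertex $x$ satisfies $CD(K,N,x)$ ($K\in\mathbb R$, $N\in(0,\infty]$) if $\Gamma_2(f)(x)\ge\frac1N(\Delta f(x))^2+K\Gamma(f)(x)$ for all $f$; $G$ has non-negative Bakry-Émery curvature if it satisfies $CD(K,N,x)$ at all $x$ for some $K\ge0$ and $N\in(0,\infty]$. $M_2^{\mathrm{path}}(G)$: 1-forms are antisymmetric functions $\alpha(x,y)=-\alpha(y,x)$ on ordered adjacent pairs; its 2-cells are all cycles $(x_0\sim\dots\sim x_{n-1})$ of distinct vertices with $n\in\{3,4\}$ and $x_{n-1}\sim x_0$; $\delta\alpha(c)=\sum_i\alpha(x_i,x_{i+1\bmod n})$; $\delta^*\alpha(x)=\sum_y\frac{w(x,y)}{\mu(x)}\alpha(x,y)$;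 $H_1(M_2^{\mathrm{path}}(G))=\{\alpha:\delta\alpha=0\text{ on all such cycles},\ \delta^*\alpha\equiv0\}$ and $\beta_1=\dim H_1$.
   Formalization: For the one-vertex graph (deg_min = 0, β₁ = 0) the stated bound 0 ≤ −1 fails; the formal version reads deg_min − 1 as max(deg_min − 1, 0), which changes nothing for graphs with at least two vertices. *)

theory Defs
  imports "HOL-Analysis.Analysis"
begin

locale weighted_graph =
  fixes w :: "'v::finite \<Rightarrow> 'v \<Rightarrow> real" and \<mu> :: "'v \<Rightarrow> real"
  assumes w_nonneg: "0 \<le> w x y"
    and w_sym: "w x y = w y x"
    and w_diag: "w x x = 0"
    and \<mu>_pos: "0 < \<mu> x"

definition adj :: "('v \<Rightarrow> 'v \<Rightarrow> real) \<Rightarrow> 'v \<Rightarrow> 'v \<Rightarrow> bool" where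
  "adj w x y \<longleftrightarrow> w x y > 0"

definition graph_connected :: "('v \<Rightarrow> 'v \<Rightarrow> real) \<Rightarrow> bool" where
  "graph_connected w \<longleftrightarrow> (\<forall>x y. (adj w)\<^sup>*\<^sup>* x y)"

definition vdeg :: "('v \<Rightarrow> 'v \<Rightarrow> real) \<Rightarrow> 'v \<Rightarrow> nat" where
  "vdeg w x = card {y. adj w y x}"

text \<open>A connected graph has \<open>deg_min w \<ge> 1\<close> unless it consists of a single vertex. Hence
  \<open>deg_min w - 1\<close> on \<open>nat\<close> is ordinary subtraction except for the one-vertex graph, where
  it is \<open>0\<close>.\<close>
definition deg_min :: "('v \<Rightarrow> 'v \<Rightarrow> real) \<Rightarrow> nat" where
  "deg_min w = Min (range (vdeg w))"

definition laplacian ::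
    "('v::finite \<Rightarrow> 'v \<Rightarrow> real) \<Rightarrow> ('v \<Rightarrow> real) \<Rightarrow> ('v \<Rightarrow> real) \<Rightarrow> 'v \<Rightarrow> real" where
  "laplacian w \<mu> f x = (\<Sum>y\<in>UNIV. w x y / \<mu> x * (f y - f x))"

definition Gamma_form :: "('v::finite \<Rightarrow> 'v \<Rightarrow> real) \<Rightarrow> ('v \<Rightarrow> real) \<Rightarrow>
    ('v \<Rightarrow> real) \<Rightarrow> ('v \<Rightarrow> real) \<Rightarrow> 'v \<Rightarrow> real" where
  "Gamma_form w \<mu> f g x = 1 / 2 *
     (laplacian w \<mu> (\<lambda>y. f y * g y) x - f x * laplacian w \<mu> g x - g x * laplacian w \<mu> f x)"

definition Gamma2_form :: "('v::finite \<Rightarrow> 'v \<Rightarrow> real) \<Rightarrow> ('v \<Rightarrow> real) \<Rightarrow>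
    ('v \<Rightarrow> real) \<Rightarrow> ('v \<Rightarrow> real) \<Rightarrow> 'v \<Rightarrow> real" where
  "Gamma2_form w \<mu> f g x = 1 / 2 *
     (laplacian w \<mu> (Gamma_form w \<mu> f g) x
      - Gamma_form w \<mu> f (laplacian w \<mu> g) x
      - Gamma_form w \<mu> g (laplacian w \<mu> f) x)"

text \<open>The dimension parameter \<open>N\<close> is meant to range over \<open>(0, \<infinity>]\<close>; in \<open>ereal\<close> one has
  \<open>1 / \<infinity> = 0\<close>, so the term \<open>(\<Delta> f)\<^sup>2 / N\<close> disappears for \<open>N = \<infinity>\<close>.\<close>
definition CD :: "('v::finite \<Rightarrow> 'v \<Rightarrow> real) \<Rightarrow> ('v \<Rightarrow> real) \<Rightarrow> real \<Rightarrow> ereal \<Rightarrow> 'v \<Rightarrow> bool" where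
  "CD w \<mu> K N x \<longleftrightarrow> (\<forall>f. Gamma2_form w \<mu> f f x \<ge>
     real_of_ereal (1 / N) * (laplacian w \<mu> f x)\<^sup>2 + K * Gamma_form w \<mu> f f x)"

definition nonneg_BE_curvature ::
    "('v::finite \<Rightarrow> 'v \<Rightarrow> real) \<Rightarrow> ('v \<Rightarrow> real) \<Rightarrow> bool" where
  "nonneg_BE_curvature w \<mu> \<longleftrightarrow>
     (\<exists>K::real. \<exists>N::ereal. K \<ge> 0 \<and> N > 0 \<and> (\<forall>x. CD w \<mu> K N x))"

text \<open>A function on ordered adjacent pairs is encoded as a matrix whose entries vanish at all
  non-adjacent pairs, so that \<open>dim\<close> gives the dimension of a space of 1-forms.\<close>
definition one_forms :: "('v::finite \<Rightarrow> 'v \<Rightarrow> real) \<Rightarrow> (real ^ 'v ^ 'v) set" where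
  "one_forms w = {\<alpha>. (\<forall>x y. adj w x y \<longrightarrow> \<alpha> $ x $ y = - \<alpha> $ y $ x) \<and>
                     (\<forall>x y. \<not> adj w x y \<longrightarrow> \<alpha> $ x $ y = 0)}"

definition path_2cells :: "('v \<Rightarrow> 'v \<Rightarrow> real) \<Rightarrow> 'v list set" where
  "path_2cells w = {c. length c \<in> {3, 4} \<and> distinct c \<and>
     (\<forall>i<length c. adj w (c ! i) (c ! (Suc i mod length c)))}"

definition coboundary :: "real ^ 'v ^ 'v \<Rightarrow> 'v::finite list \<Rightarrow> real" where
  "coboundary \<alpha> c = (\<Sum>i<length c. \<alpha> $ (c ! i) $ (c ! (Suc i mod length c)))"

definition codifferential ::
    "('v::finite \<Rightarrow> 'v \<Rightarrow> real) \<Rightarrow> ('v \<Rightarrow> real) \<Rightarrow> real ^ 'v ^ 'v \<Rightarrow> 'v \<Rightarrow> real" where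
  "codifferential w \<mu> \<alpha> x = (\<Sum>y\<in>UNIV. w x y / \<mu> x * \<alpha> $ x $ y)"

definition H1_path ::
    "('v::finite \<Rightarrow> 'v \<Rightarrow> real) \<Rightarrow> ('v \<Rightarrow> real) \<Rightarrow> (real ^ 'v ^ 'v) set" where
  "H1_path w \<mu> = {\<alpha> \<in> one_forms w.
     (\<forall>c\<in>path_2cells w. coboundary \<alpha> c = 0) \<and> (\<forall>x. codifferential w \<mu> \<alpha> x = 0)}"

lemma subspace_H1_path: "subspace (H1_path w \<mu>)"
proof -
  have [simp]: "coboundary 0 c = 0" "coboundary (\<alpha> + \<beta>) c = coboundary \<alpha> c + coboundary \<beta> c"
    "coboundary (r *\<^sub>R \<alpha>) c = r * coboundary \<alpha> c" for r c and \<alpha> \<beta> :: "real ^ 'a ^ 'a"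
    by (simp_all add: coboundary_def sum.distrib sum_distrib_left)
  have [simp]: "codifferential w \<mu> 0 x = 0"
    "codifferential w \<mu> (\<alpha> + \<beta>) x = codifferential w \<mu> \<alpha> x + codifferential w \<mu> \<beta> x"
    "codifferential w \<mu> (r *\<^sub>R \<alpha>) x = r * codifferential w \<mu> \<alpha> x" for r x \<alpha> \<beta>
    by (simp_all add: codifferential_def sum.distrib sum_distrib_left algebra_simps)
  show ?thesis
    unfolding subspace_def H1_path_def one_forms_def by auto
qed

definition betti1_path :: "('v::finite \<Rightarrow> 'v \<Rightarrow> real) \<Rightarrow> ('v \<Rightarrow> real) \<Rightarrow> nat" where
  "betti1_path w \<mu> = dim (H1_path w \<mu>)"

end

theory Submission
  imports Defs
begin

text \<open>A harmonic 1-form \<open>\<alpha>\<close> that is closed on triangles and 4-cycles is, on the edges meeting the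
  unit ball around a vertex, the differential of a function \<open>f\<close> which is harmonic on that ball. The
  curvature condition for \<open>f\<close> then says that the pointwise energy of \<open>\<alpha>\<close> is subharmonic, hence
  constant. So \<open>\<alpha>\<close> is determined by its values on the edges at a single vertex \<open>x\<close>, and these
  satisfy one nontrivial linear relation, the vanishing of the codifferential at \<open>x\<close>.\<close>

lemma (in weighted_graph) adj_sym: "adj w x y \<Longrightarrow> adj w y x"
  using w_sym[of x y] by (simp add: adj_def)

lemma (in weighted_graph) not_adj_self: "\<not> adj w x x"
  by (simp add: adj_def w_diag)

lemma (in weighted_graph) not_adj_weight: "\<not> adj w x y \<Longrightarrow> w x y = 0"
  using w_nonneg[of x y] by (simp add: adj_def)

text \<open>The product rule for differences turns \<open>Gamma_form\<close> into a weighted sum of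
  products of increments. In this form its positivity and its locality can be read off.\<close>

lemma Gamma_form_eq:
  "Gamma_form w \<mu> f g x = 1 / 2 * (\<Sum>y\<in>UNIV. w x y / \<mu> x * ((f y - f x) * (g y - g x)))"
proof -
  have "laplacian w \<mu> (\<lambda>y. f y * g y) x - f x * laplacian w \<mu> g x - g x * laplacian w \<mu> f x
      = (\<Sum>y\<in>UNIV. w x y / \<mu> x * (f y * g y - f x * g x)
          - f x * (w x y / \<mu> x * (g y - g x)) - g x * (w x y / \<mu> x * (f y - f x)))"
    by (simp only: laplacian_def sum_distrib_left sum_subtractf)
  also have "\<dots> = (\<Sum>y\<in>UNIV. w x y / \<mu> x * ((f y - f x) * (g y - g x)))"
    by (intro sum.cong refl) algebra
  finally show ?thesis
    by (simp only: Gamma_form_def)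
qed

context weighted_graph
begin

lemma laplacian_cong:
  assumes "f x = g x" "\<And>y. adj w x y \<Longrightarrow> f y = g y"
  shows "laplacian w \<mu> f x = laplacian w \<mu> g x"
  unfolding laplacian_def using assms not_adj_weight by (intro sum.cong) force+

lemma Gamma_form_nonneg: "0 \<le> Gamma_form w \<mu> f f x"
  unfolding Gamma_form_eq using w_nonneg \<mu>_pos
  by (intro mult_nonneg_nonneg[of "1 / 2"] sum_nonneg mult_nonneg_nonneg[of "w x y / \<mu> x" for y])
     (auto simp: less_imp_le)

lemma nonneg_BE_curvature_Gamma2_nonneg:
  assumes "nonneg_BE_curvature w \<mu>"
  shows "0 \<le> Gamma2_form w \<mu> f f x"
proof -
  obtain K N where KN: "K \<ge> 0" "N > 0" "CD w \<mu> K N x"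
    using assms unfolding nonneg_BE_curvature_def by blast
  have "0 \<le> real_of_ereal (1 / N)"
    using KN(2) by (intro real_of_ereal_pos) (cases N, auto)
  then have "0 \<le> real_of_ereal (1 / N) * (laplacian w \<mu> f x)\<^sup>2 + K * Gamma_form w \<mu> f f x"
    using KN(1) Gamma_form_nonneg by simp
  also have "\<dots> \<le> Gamma2_form w \<mu> f f x"
    using KN(3) unfolding CD_def by blast
  finally show ?thesis .
qed

lemma H1_path_antisym: "\<alpha> \<in> H1_path w \<mu> \<Longrightarrow> adj w x y \<Longrightarrow> \<alpha> $ x $ y = - \<alpha> $ y $ x"
  by (auto simp: H1_path_def one_forms_def)

lemma H1_path_triangle:
  assumes "\<alpha> \<in> H1_path w \<mu>" "adj w x y" "adj w y z" "adj w z x"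
  shows "\<alpha> $ x $ y + \<alpha> $ y $ z + \<alpha> $ z $ x = 0"
proof -
  have "distinct [x, y, z]"
    using assms not_adj_self by auto
  then have "[x, y, z] \<in> path_2cells w"
    using assms by (auto simp: path_2cells_def less_Suc_eq)
  then have "coboundary \<alpha> [x, y, z] = 0"
    using assms by (auto simp: H1_path_def)
  then show ?thesis
    by (simp add: coboundary_def)
qed

lemma H1_path_square:
  assumes "\<alpha> \<in> H1_path w \<mu>" "adj w x y" "adj w y z" "adj w z u" "adj w u x" "x \<noteq> z" "y \<noteq> u"
  shows "\<alpha> $ x $ y + \<alpha> $ y $ z + \<alpha> $ z $ u + \<alpha> $ u $ x = 0"
proof -
  have "distinct [x, y, z, u]"
    using assms not_adj_self by auto
  then have "[x, y, z, u] \<in> path_2cells w"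
    using assms by (auto simp: path_2cells_def less_Suc_eq)
  then have "coboundary \<alpha> [x, y, z, u] = 0"
    using assms by (auto simp: H1_path_def)
  then show ?thesis
    by (simp add: coboundary_def)
qed

text \<open>\<open>f\<close> integrates \<alpha> along a path of length at most 2 from
  \<open>x\<close>. Comparing two such paths, or such paths with an edge \<open>y z\<close>, only
  produces backtracks, triangles and 4-cycles, on all of which \<alpha> sums to 0.\<close>

lemma H1_path_local_potential:
  assumes \<alpha>: "\<alpha> \<in> H1_path w \<mu>"
  obtains f where "\<And>y z. y = x \<or> adj w x y \<Longrightarrow> adj w y z \<Longrightarrow> f z - f y = \<alpha> $ y $ z"
proof -
  \<comment> \<open>An arbitrary midpoint of a path from \<open>x\<close> to \<open>z\<close>; it
    matters only for \<open>z\<close> at distance 2.\<close>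
  define p where "p z = (SOME y. adj w x y \<and> adj w y z)" for z
  define f where "f z = (if z = x then 0 else if adj w x z then \<alpha> $ x $ z
    else \<alpha> $ x $ p z + \<alpha> $ p z $ z)" for z
  have "f z - f y = \<alpha> $ y $ z" if y: "y = x \<or> adj w x y" and yz: "adj w y z" for y z
  proof (cases "y = x")
    case True
    then show ?thesis
      using yz not_adj_self by (auto simp: f_def)
  next
    case False
    then have xy: "adj w x y"
      using y by blast
    then have fy: "f y = \<alpha> $ x $ y"
      using False by (simp add: f_def)
    consider "z = x" | "z \<noteq> x" "adj w x z" | "z \<noteq> x" "\<not> adj w x z"
      by blast
    then show ?thesis
    proof cases
      case 1
      then show ?thesis
        using fy H1_path_antisym[OF \<alpha> xy] by (simp add: f_def)
    next
      case 2
      then show ?thesis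
        using fy H1_path_triangle[OF \<alpha> xy yz adj_sym] H1_path_antisym[OF \<alpha>, of x z]
        by (simp add: f_def)
    next
      case 3
      have p: "adj w x (p z)" "adj w (p z) z"
        using someI[of "\<lambda>y. adj w x y \<and> adj w y z" y] xy yz by (auto simp: p_def)
      \<comment> \<open>The paths through \<open>y\<close> and \<open>p z\<close> bound a genuine
        4-cycle only if these midpoints differ; otherwise the definition of \<open>f\<close> already
        gives the claim.\<close>
      show ?thesis
      proof (cases "y = p z")
        case True
        then show ?thesis
          using fy 3 by (simp add: f_def)
      next
        case False
        then show ?thesis
          using fy 3 H1_path_square[OF \<alpha> xy yz adj_sym adj_sym, of "p z"] p
            H1_path_antisym[OF \<alpha> p(1)] H1_path_antisym[OF \<alpha> p(2)]
          by (simp add: f_def)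
      qed
    qed
  qed
  then show ?thesis
    using that by blast
qed

text \<open>This equals \<Gamma>(f)(x) whenever \<alpha> is the differential of f on the edges at
  \<open>x\<close>, but it is defined globally, without a potential.\<close>

definition energy :: "real ^ 'v ^ 'v \<Rightarrow> 'v \<Rightarrow> real" where
  "energy \<alpha> x = 1 / 2 * (\<Sum>y\<in>UNIV. w x y / \<mu> x * (\<alpha> $ x $ y)\<^sup>2)"

text \<open>For a local potential \<open>f\<close> around \<open>x\<close>, \<Delta>f vanishes on
  the unit ball, so \<Gamma>(f, \<Delta>f)(x) = 0 and \<Gamma>_2(f)(x) reduces to half of
  \<Delta>\<Gamma>(f)(x). On this ball \<Gamma>(f) is the energy.\<close>

lemma energy_subharmonic:
  assumes "nonneg_BE_curvature w \<mu>" and \<alpha>: "\<alpha> \<in> H1_path w \<mu>"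
  shows "0 \<le> laplacian w \<mu> (energy \<alpha>) x"
proof -
  obtain f where f: "\<And>y z. y = x \<or> adj w x y \<Longrightarrow> adj w y z \<Longrightarrow> f z - f y = \<alpha> $ y $ z"
    using H1_path_local_potential[OF \<alpha>] by blast
  have lap: "laplacian w \<mu> f y = 0" if y: "y = x \<or> adj w x y" for y
  proof -
    have "laplacian w \<mu> f y = codifferential w \<mu> \<alpha> y"
      unfolding laplacian_def codifferential_def using f[OF y] not_adj_weight
      by (intro sum.cong) force+
    then show ?thesis
      using \<alpha> by (simp add: H1_path_def)
  qed
  have en: "Gamma_form w \<mu> f f y = energy \<alpha> y" if y: "y = x \<or> adj w x y" for y
  proof -
    have "w y z / \<mu> y * ((f z - f y) * (f z - f y)) = w y z / \<mu> y * (\<alpha> $ y $ z)\<^sup>2" for z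
      using f[OF y, of z] not_adj_weight[of y z] by (cases "adj w y z") (auto simp: power2_eq_square)
    then show ?thesis
      unfolding Gamma_form_eq energy_def by presburger
  qed
  \<comment> \<open>Away from the ball \<Delta>f need not vanish, but there the weight
    \<open>w x y\<close> is 0.\<close>
  have "w x y / \<mu> x * ((f y - f x) * (laplacian w \<mu> f y - laplacian w \<mu> f x)) = 0" for y
    using lap[of x] lap[of y] not_adj_weight[of x y] by (cases "adj w x y") auto
  then have "Gamma_form w \<mu> f (laplacian w \<mu> f) x = 0"
    by (simp add: Gamma_form_eq del: mult_eq_0_iff divide_eq_0_iff)
  moreover have "laplacian w \<mu> (Gamma_form w \<mu> f f) x = laplacian w \<mu> (energy \<alpha>) x"
    using en by (intro laplacian_cong) auto
  ultimately show ?thesis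
    using nonneg_BE_curvature_Gamma2_nonneg[OF assms(1), of f x] by (simp add: Gamma2_form_def)
qed

text \<open>Maximum principle: where \<open>u\<close> is maximal, all terms of its Laplacian are
  non-positive while their sum is non-negative, so the maximum passes to every neighbour and, by
  connectedness, to every vertex.\<close>

lemma subharmonic_constant:
  assumes "graph_connected w" and sub: "\<And>x. 0 \<le> laplacian w \<mu> u x"
  shows "u x = u y"
proof -
  define M where "M = Max (range u)"
  have le: "u z \<le> M" for z
    by (simp add: M_def)
  have "M \<in> range u"
    unfolding M_def by (rule Max_in) auto
  then obtain a where a: "u a = M"
    by auto
  have step: "u z = M" if uy: "u y = M" and yz: "adj w y z" for y z
  proof -
    have nonpos: "w y v / \<mu> y * (u v - u y) \<le> 0" for v
      using le[of v] uy w_nonneg[of y v] \<mu>_pos[of y] by (intro mult_nonneg_nonpos) auto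
    have "(\<Sum>v\<in>UNIV. w y v / \<mu> y * (u v - u y)) = 0"
      using sub[of y] sum_nonpos[of UNIV "\<lambda>v. w y v / \<mu> y * (u v - u y)"] nonpos
      by (simp add: laplacian_def)
    then have "w y z / \<mu> y * (u z - u y) = 0"
      using sum_nonneg_eq_0_iff[of UNIV "\<lambda>v. - (w y v / \<mu> y * (u v - u y))"] nonpos
      by (simp add: sum_negf)
    then show ?thesis
      using yz \<mu>_pos[of y] uy by (simp add: adj_def)
  qed
  have "u z = M" for z
  proof -
    have "(adj w)\<^sup>*\<^sup>* a z"
      using assms(1) by (simp add: graph_connected_def)
    then show ?thesis
      by induction (use a step in auto)
  qed
  then show ?thesis
    by simp
qed

text \<open>The energy is constant and vanishes at \<open>x\<close>, hence everywhere. As a sum of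
  squares with positive weights on edges, it then forces every value of \<alpha> to be 0.\<close>

lemma H1_path_vanish_at_vertex:
  assumes "graph_connected w" "nonneg_BE_curvature w \<mu>" "\<alpha> \<in> H1_path w \<mu>" "\<alpha> $ x = 0"
  shows "\<alpha> = 0"
proof -
  have "\<alpha> $ y $ z = 0" for y z
  proof (cases "adj w y z")
    case True
    have "energy \<alpha> y = energy \<alpha> x"
      using assms by (intro subharmonic_constant energy_subharmonic)
    also have "\<dots> = 0"
      using assms(4) by (simp add: energy_def)
    finally have "(\<Sum>z\<in>UNIV. w y z / \<mu> y * (\<alpha> $ y $ z)\<^sup>2) = 0"
      by (simp add: energy_def)
    then have "w y z / \<mu> y * (\<alpha> $ y $ z)\<^sup>2 = 0"
      using w_nonneg \<mu>_pos by (subst (asm) sum_nonneg_eq_0_iff) (auto simp: less_imp_le)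
    then show ?thesis
      using True \<mu>_pos[of y] by (simp add: adj_def)
  next
    case False
    then show ?thesis
      using assms(3) by (simp add: H1_path_def one_forms_def)
  qed
  then show ?thesis
    by (simp add: vec_eq_iff)
qed

text \<open>Taking the row at \<open>x\<close> is injective on \<open>H1_path w \<mu>\<close>, and
  the rows obtained lie in the kernel of a linear functional on a space of dimension
  \<open>vdeg w x\<close>.\<close>

lemma dim_H1_path_le:
  assumes "graph_connected w" "nonneg_BE_curvature w \<mu>"
  shows "dim (H1_path w \<mu>) \<le> vdeg w x - 1"
proof -
  define T where "T = (\<lambda>\<alpha> :: real ^ 'v ^ 'v. \<alpha> $ x)"
  define L where "L = {v :: real ^ 'v. \<forall>y. y \<notin> {y. adj w y x} \<longrightarrow> v $ y = 0}"
  \<comment> \<open>The equation is the vanishing of the codifferential at \<open>x\<close>,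
    multiplied by \<open>\<mu> x\<close>.\<close>
  define S where "S = {v \<in> L. (\<Sum>y\<in>UNIV. w x y * v $ y) = 0}"
  have adj_comm: "adj w y x \<longleftrightarrow> adj w x y" for y
    using adj_sym by blast
  have dimL: "dim L = vdeg w x"
    unfolding L_def vdeg_def dim_vec_eq[symmetric] by (rule dim_substandard_cart)
  have linT: "linear T"
    by (rule linearI) (simp_all add: T_def)
  have "inj_on T (H1_path w \<mu>)"
    unfolding linear_injective_on_subspace_0[OF linT subspace_H1_path]
    using H1_path_vanish_at_vertex[OF assms] by (auto simp: T_def)
  then have "dim (H1_path w \<mu>) = dim (T ` H1_path w \<mu>)"
    using dim_image_eq[OF linT] subspace_H1_path by (metis span_eq_iff)
  also have "\<dots> \<le> dim S"
  proof (rule dim_subset, safe)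
    fix \<alpha> assume \<alpha>: "\<alpha> \<in> H1_path w \<mu>"
    have "(\<Sum>y\<in>UNIV. w x y * \<alpha> $ x $ y) / \<mu> x = 0"
      using \<alpha> by (simp add: H1_path_def codifferential_def sum_divide_distrib)
    then show "T \<alpha> \<in> S"
      using \<alpha> \<mu>_pos[of x] by (auto simp: S_def L_def T_def H1_path_def one_forms_def adj_comm)
  qed
  also have "\<dots> \<le> vdeg w x - 1"
  proof (cases "\<exists>y. adj w y x")
    case True
    then obtain y where y: "w x y > 0"
      using adj_comm by (auto simp: adj_def)
    have subS: "subspace S" and subL: "subspace L"
      by (auto simp: S_def L_def subspace_def algebra_simps sum.distrib simp flip: sum_distrib_left)
    \<comment> \<open>The row of weights itself witnesses that \<open>S\<close> is a proper
      subspace: the functional takes a positive sum of squares on it.\<close>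
    have "(\<Sum>y\<in>UNIV. w x y * w x y) > 0"
      using y by (intro sum_pos2[of UNIV y]) auto
    then have "(\<chi> y. w x y) \<in> L - S"
      using not_adj_weight by (auto simp: L_def S_def adj_comm)
    then have "S \<subset> L"
      unfolding S_def by blast
    then have "span S \<subset> span L"
      using subS subL by (metis span_eq_iff)
    then have "dim S < dim L"
      by (rule dim_psubset)
    then show ?thesis
      using dimL by simp
  next
    case False
    \<comment> \<open>At an isolated vertex the truncated subtraction gives 0, and \<open>L\<close>
      already has dimension 0.\<close>
    then have "vdeg w x = 0"
      by (simp add: vdeg_def)
    moreover have "dim S \<le> dim L"
      by (rule dim_subset) (auto simp: S_def)
    ultimately show ?thesis
      using dimL by linarith
  qed
  finally show ?thesis .
qed

end

theorem theorem3p9: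
  fixes w :: "'v::finite \<Rightarrow> 'v \<Rightarrow> real" and \<mu> :: "'v \<Rightarrow> real"
  assumes "weighted_graph w \<mu>"
    and "graph_connected w"
    and "nonneg_BE_curvature w \<mu>"
  shows "betti1_path w \<mu> \<le> deg_min w - 1"
proof -
  interpret weighted_graph w \<mu>
    by fact
  \<comment> \<open>The dimension bound holds at every vertex, so it is applied at one of minimal
    degree.\<close>
  have "deg_min w \<in> range (vdeg w)"
    unfolding deg_min_def by (rule Min_in) auto
  then obtain x where "deg_min w = vdeg w x"
    by auto
  then show ?thesis
    using dim_H1_path_le[OF assms(2,3), of x] by (simp add: betti1_path_def)
qed

end
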